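(* Let $k\ge d$. Draw $(\mathbf x_1,\dots,\mathbf x_k)\sim\mathrm{VS}_{D_{\mathcal X}}^k$ and then, conditionally on these points, draw $y_i\sim D_{\mathcal Y|\mathbf x=\mathbf x_i}$ independently for $i=1,\dots,k$; call the law of ${\mathbb S}=\{(\mathbf x_1,y_1),\dots,(\mathbf x_k,y_k)\}$ $\mathrm{VS}_D^k$. Then $\mathbb E_{\mathrm{VS}_D^k}[\mathbf w^*({\mathbb S})]=\mathbf w^*_D$.
   Context: $D$ is a probability distribution of $(\mathbf x,y)\in\mathbb R^d\times\mathbb R$ with $\mathbb E\|\mathbf x\|^2<\infty$, $\mathbb E[y^2]<\infty$; $D_{\mathcal X}$ is the marginal of $\mathbf x$ and $D_{\mathcal Y|\mathbf x}$ the conditional law of $y$ given $\mathbf x$. $\boldsymbol\Sigma_{D_{\mathcal X}}:=\mathbb E[\mathbf x\mathbf x^\top]$ is assumed invertible. $\mathbf w^*_D:=\boldsymbol\Sigma_{D_{\mathcal X}}^{-1}\mathbb E_D[\mathbf x y]$ (the minimizer of $\mathbb E_D[(\mathbf x^\top\mathbf w-y)^2]$). For a sample ${\mathbb S}$ with design matrix $\mathbf X\in\mathbb R^{k\times d}$ (rows $\mathbf x_i^\top$) and responses $\mathbf y\in\mathbb R^k$, $\mathbf w^*({\mathbb S}):=\mathbf X^+\mathbf y$ (the least squares solution, $\mathbf X^+$ the Moore–Penrose pseudoinverse). $D_{\mathcal X}^k$ is the law of $k$ i.i.d. draws from $D_{\mathcal X}$, and $\mathrm{VS}_{D_{\mathcal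 X}}^k$ is the probability measure on $(\mathbb R^d)^k$ given by $\mathrm{VS}_{D_{\mathcal X}}^k(A)=\mathbb E_{D_{\mathcal X}^k}[\mathbf 1_A\det(\sum_{i=1}^k\mathbf x_i\mathbf x_i^\top)]/\big(d!\binom kd\det(\boldsymbol\Sigma_{D_{\mathcal X}})\big)$. *)

theory Defs
  imports "HOL-Probability.Probability"
begin

definition pinv :: "real^'d::finite^'k::finite \<Rightarrow> real^'k^'d" where
  "pinv A = (THE P. A ** P ** A = A \<and> P ** A ** P = P \<and>
                    transpose (A ** P) = A ** P \<and> transpose (P ** A) = P ** A)"

definition outer :: "real^'d \<Rightarrow> real^'d^'d" where
  "outer x = (\<chi> i j. x $ i * x $ j)"

definition design :: "('k::finite \<Rightarrow> real^'d) \<Rightarrow> real^'d^'k" where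
  "design xs = (\<chi> i. xs i)"

definition joint :: "(real^'d) measure \<Rightarrow> (real^'d \<Rightarrow> real measure) \<Rightarrow> ((real^'d) \<times> real) measure" where
  "joint DX K = DX \<bind> (\<lambda>x. K x \<bind> (\<lambda>y. return (borel \<Otimes>\<^sub>M borel) (x, y)))"

definition Sigma :: "(real^'d) measure \<Rightarrow> real^'d^'d" where
  "Sigma DX = integral\<^sup>L DX outer"

definition wstar_D :: "(real^'d) measure \<Rightarrow> (real^'d \<Rightarrow> real measure) \<Rightarrow> real^'d" where
  "wstar_D DX K = matrix_inv (Sigma DX) *v integral\<^sup>L (joint DX K) (\<lambda>(x, y). y *\<^sub>R x)"

definition wstar_S :: "('k::finite \<Rightarrow> real^'d) \<Rightarrow> ('k \<Rightarrow> real) \<Rightarrow> real^'d" where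
  "wstar_S xs ys = pinv (design xs) *v (\<chi> i. ys i)"

definition VS_X :: "(real^'d) measure \<Rightarrow> ('k::finite \<Rightarrow> real^'d) measure" where
  "VS_X DX = density (PiM UNIV (\<lambda>_. DX))
     (\<lambda>xs. ennreal (det (transpose (design xs) ** design xs)
        / (fact CARD('d) * real (CARD('k) choose CARD('d)) * det (Sigma DX))))"

definition VS_D :: "(real^'d) measure \<Rightarrow> (real^'d \<Rightarrow> real measure)
    \<Rightarrow> (('k::finite \<Rightarrow> real^'d) \<times> ('k \<Rightarrow> real)) measure" where
  "VS_D DX K = VS_X DX \<bind> (\<lambda>xs. distr (PiM UNIV (\<lambda>i. K (xs i)))
      (PiM UNIV (\<lambda>_. borel) \<Otimes>\<^sub>M PiM UNIV (\<lambda>_. borel)) (\<lambda>ys. (xs, ys)))"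

end

theory Submission
  imports Defs
begin

text \<open>
  For every design, full rank or not, the normal equations and Cramer's rule give
  \<open>det (X\<^sup>T X) (X\<^sup>+ y)\<^sub>a = det (\<Sum>\<^sub>i x\<^sub>i z\<^sub>i\<^sup>T)\<close>, where \<open>z\<^sub>i\<close> is \<open>x\<^sub>i\<close> with
  coordinate \<open>a\<close> replaced by \<open>y\<^sub>i\<close>. The volume weight is therefore exactly what turns the
  estimator into a polynomial. Expanding this determinant multilinearly, only terms that use
  pairwise distinct sample points survive; hence each of them is integrable under second moments and, by
  independence, the expectation is \<open>d! (k choose d) det (E x z\<^sup>T)\<close>. Cramer's rule for
  \<open>\<Sigma> w = E x y\<close> evaluates the last determinant as \<open>(w\<^sup>*\<^sub>D)\<^sub>a det \<Sigma>\<close>.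
\<close>

section \<open>Determinants and Gram matrices\<close>

text \<open>As a simp rule it would turn \<open>transpose A *v y\<close> into a product with
  \<open>v*\<close>, and the normal equations would lose the form used below.\<close>

declare transpose_matrix_vector [simp del]

text \<open>Evaluating along a fixed enumeration of \<open>'d\<close> turns injections into
  repetition-free lists, whose number is known. This count is the source of the combinatorial factor
  in the normalization of \<open>VS_X\<close>.\<close>

lemma card_inj_functions:
  assumes "CARD('d::finite) \<le> CARD('k::finite)"
  shows "card {f :: 'd \<Rightarrow> 'k. inj f} = fact CARD('d) * (CARD('k) choose CARD('d))"
proof -
  obtain ds :: "'d list" where ds: "set ds = UNIV" "distinct ds"
    using finite_distinct_list[of "UNIV :: 'd set"] by auto
  then have len: "length ds = CARD('d)"
    by (metis distinct_card)
  have "bij_betw (\<lambda>f :: 'd \<Rightarrow> 'k. map f ds) {f. inj f} {xs. length xs = CARD('d) \<and> distinct xs \<and> set xs \<subseteq> UNIV}"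
  proof (intro bij_betwI')
    fix f g :: "'d \<Rightarrow> 'k"
    show "(map f ds = map g ds) = (f = g)"
      using ds by (auto simp: map_eq_conv)
  next
    fix f :: "'d \<Rightarrow> 'k" assume "f \<in> {f. inj f}"
    then show "map f ds \<in> {xs. length xs = CARD('d) \<and> distinct xs \<and> set xs \<subseteq> UNIV}"
      using ds len by (auto simp: distinct_map)
  next
    fix xs :: "'k list" assume xs: "xs \<in> {xs. length xs = CARD('d) \<and> distinct xs \<and> set xs \<subseteq> UNIV}"
    define f where "f = (\<lambda>d. the (map_of (zip ds xs) d))"
    have "map f ds = xs"
      using xs ds len by (intro nth_equalityI) (auto simp: f_def map_of_zip_nth)
    moreover then have "inj f"
      using xs ds by (auto simp: distinct_map)
    ultimately show "\<exists>f\<in>{f. inj f}. xs = map f ds" by auto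
  qed
  then have "card {f :: 'd \<Rightarrow> 'k. inj f} = card {xs :: 'k list. length xs = CARD('d) \<and> distinct xs \<and> set xs \<subseteq> UNIV}"
    by (rule bij_betw_same_card)
  also have "\<dots> = \<Prod>{CARD('k) - CARD('d) + 1..CARD('k)}"
    using assms by (intro card_lists_distinct_length_eq) auto
  also have "\<dots> = fact CARD('k) div fact (CARD('k) - CARD('d))"
    by (simp add: fact_div_fact)
  also have "\<dots> = fact CARD('d) * (CARD('k) choose CARD('d))"
    by (subst binomial_fact_lemma[OF assms, symmetric]) (simp add: mult.assoc mult.left_commute[of "fact CARD('d)"])
  finally show ?thesis .
qed

text \<open>A Cauchy-Binet type expansion: \<open>f r\<close> records which summand is picked in row
  \<open>r\<close>. If \<open>f\<close> is not injective, two rows are the same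
  \<open>v (f r)\<close> and the term vanishes.\<close>

lemma det_sum_outer_products:
  fixes u v :: "'k::finite \<Rightarrow> 'd::finite \<Rightarrow> real"
  shows "det (\<chi> r c. \<Sum>i\<in>UNIV. u i r * v i c) =
    (\<Sum>f | inj f. \<Sum>p | p permutes UNIV. of_int (sign p) * (\<Prod>r\<in>UNIV. u (f r) r * v (f r) (p r)))"
proof -
  have "det (\<chi> r c. \<Sum>i\<in>UNIV. u i r * v i c) =
      (\<Sum>p | p permutes UNIV. of_int (sign p) * (\<Sum>f\<in>UNIV. \<Prod>r\<in>UNIV. u (f r) r * v (f r) (p r)))"
    by (simp add: det_def prod_sum_PiE)
  \<comment> \<open>The factors \<open>u (f r) r\<close> do not depend on the permutation, so for
    fixed \<open>f\<close> the inner sum is again a determinant, with rows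
    \<open>v (f r)\<close>.\<close>
  also have "\<dots> = (\<Sum>f\<in>UNIV. (\<Prod>r\<in>UNIV. u (f r) r) * det (\<chi> r. (\<chi> c. v (f r) c)))"
    unfolding sum_distrib_left
    by (subst sum.swap) (simp add: det_def sum_distrib_left prod.distrib mult_ac)
  also have "\<dots> = (\<Sum>f | inj f. (\<Prod>r\<in>UNIV. u (f r) r) * det (\<chi> r. (\<chi> c. v (f r) c)))"
  proof (rule sum.mono_neutral_right)
    show "\<forall>f\<in>UNIV - {f. inj f}. (\<Prod>r\<in>UNIV. u (f r) r) * det (\<chi> r. (\<chi> c. v (f r) c)) = 0"
    proof
      fix f :: "'d \<Rightarrow> 'k"
      assume "f \<in> UNIV - {f. inj f}"
      then obtain i j where "i \<noteq> j" "f i = f j" by (auto simp: inj_def)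
      then have "det (\<chi> r. (\<chi> c. v (f r) c)) = 0"
        by (intro det_identical_rows[of i j]) (auto simp: row_def)
      then show "(\<Prod>r\<in>UNIV. u (f r) r) * det (\<chi> r. (\<chi> c. v (f r) c)) = 0" by simp
    qed
  qed auto
  also have "\<dots> = (\<Sum>f | inj f. \<Sum>p | p permutes UNIV. of_int (sign p) * (\<Prod>r\<in>UNIV. u (f r) r * v (f r) (p r)))"
    by (simp add: det_def sum_distrib_left prod.distrib mult_ac)
  finally show ?thesis .
qed

lemma pos_def_det_nonzero:
  fixes A :: "real^'n^'n"
  assumes "\<And>x. x \<noteq> 0 \<Longrightarrow> 0 < x \<bullet> (A *v x)"
  shows "det A \<noteq> 0"
proof -
  have "A *v x = 0 \<Longrightarrow> x = 0" for x
    using assms[of x] by fastforce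
  then show ?thesis
    by (metis invertible_det_nz invertible_left_inverse matrix_left_invertible_ker)
qed

text \<open>On the segment from the identity to \<open>A\<close> every matrix before the endpoint is
  positive definite, hence nonsingular. By continuity the determinant cannot pass from 1 to a
  negative value. This avoids eigenvalues.\<close>

lemma pos_semidef_det_nonneg:
  fixes A :: "real^'n^'n"
  assumes "\<And>x. 0 \<le> x \<bullet> (A *v x)"
  shows "0 \<le> det A"
proof (rule ccontr)
  assume neg: "\<not> 0 \<le> det A"
  define h where "h t = det ((1 - t) *\<^sub>R mat 1 + t *\<^sub>R A)" for t :: real
  have "continuous_on {0..1} h"
    unfolding h_def det_def by (intro continuous_intros)
  moreover have "h 0 = 1" "h 1 = det A" by (simp_all add: h_def)
  ultimately obtain t where t: "0 \<le> t" "t \<le> 1" "h t = 0"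
    using IVT2'[of h 1 0 0] neg by auto
  \<comment> \<open>The zero is not at the endpoint, because \<open>h 1\<close> is negative.\<close>
  then have "t < 1" using \<open>h 1 = det A\<close> neg by (cases "t = 1") auto
  have "h t \<noteq> 0"
    unfolding h_def
  proof (rule pos_def_det_nonzero)
    fix x :: "real^'n" assume "x \<noteq> 0"
    then have "0 < (1 - t) * (x \<bullet> x) + t * (x \<bullet> (A *v x))"
      using \<open>t < 1\<close> t assms[of x] by (intro add_pos_nonneg) auto
    then show "0 < x \<bullet> (((1 - t) *\<^sub>R mat 1 + t *\<^sub>R A) *v x)"
      by (simp add: matrix_vector_mult_add_rdistrib scaleR_matrix_vector_assoc[symmetric] inner_add_right)
  qed
  with t show False by simp
qed

lemma inner_gram:
  fixes A :: "real^'d^'k"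
  shows "x \<bullet> ((transpose A ** A) *v y) = (A *v x) \<bullet> (A *v y)"
  by (metis dot_lmul_matrix matrix_vector_mul_assoc transpose_matrix_vector inner_commute)

text \<open>The Gram matrix has the same kernel as \<open>A\<close>: if it annihilates z, then
  \<open>inner_gram\<close> makes the squared norm of \<open>A *v z\<close> zero.\<close>

lemma gram_cancel:
  fixes A :: "real^'d^'k" and B C :: "real^'n^'d"
  assumes "transpose A ** A ** B = transpose A ** A ** C"
  shows "A ** B = A ** C"
proof -
  have "A *v (B *v x) = A *v (C *v x)" for x
  proof -
    let ?z = "B *v x - C *v x"
    have "(transpose A ** A) *v ?z = 0"
      using arg_cong[OF assms, of "\<lambda>M. M *v x"]
      by (simp add: matrix_vector_mult_diff_distrib matrix_vector_mul_assoc)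
    then have "(A *v ?z) \<bullet> (A *v ?z) = 0"
      by (simp flip: inner_gram)
    then show ?thesis by (simp add: matrix_vector_mult_diff_distrib)
  qed
  then show ?thesis by (simp add: matrix_eq matrix_vector_mul_assoc)
qed

text \<open>Preimages under \<open>A\<close> can be chosen linearly on the range of
  \<open>A\<close>; the matrix of this choice is the witness.\<close>

lemma generalized_inverse_exists:
  fixes A :: "real^'n^'m"
  obtains G :: "real^'m^'n" where "A ** G ** A = A"
proof -
  obtain g where g: "linear g" "\<forall>v\<in>range ((*v) A). A *v g v = v"
    using linear_exists_right_inverse_on[of "(*v) A" UNIV] by auto
  then have "A ** matrix g ** A = A"
    by (simp add: matrix_eq matrix_works flip: matrix_vector_mul_assoc)
  then show ?thesis by (rule that)
qed

section \<open>The pseudoinverse\<close>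

text \<open>The predicate inside the definite description of \<open>pinv\<close>, named so that
  existence and uniqueness can be proved separately.\<close>

definition penrose :: "real^'d^'k \<Rightarrow> real^'k^'d \<Rightarrow> bool" where
  "penrose A P \<longleftrightarrow> A ** P ** A = A \<and> P ** A ** P = P \<and>
     transpose (A ** P) = A ** P \<and> transpose (P ** A) = P ** A"

text \<open>\<open>A ** H ** transpose A\<close> is the orthogonal projection onto the range of
  \<open>A\<close>, whichever generalized inverse \<open>H\<close> of the Gram matrix is
  taken.\<close>

lemma gram_generalized_inverse:
  fixes A :: "real^'d^'k"
  assumes "transpose A ** A ** H ** (transpose A ** A) = transpose A ** A"
  shows "A ** H ** transpose A ** A = A"
    and "transpose (A ** H ** transpose A) = A ** H ** transpose A"
proof -
  have "A ** (H ** (transpose A ** A)) = A ** mat 1"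
    by (rule gram_cancel) (use assms in \<open>simp add: matrix_mul_assoc\<close>)
  then show *: "A ** H ** transpose A ** A = A" by (simp add: matrix_mul_assoc)
  \<comment> \<open>Expanding the last factor of \<open>A ** H ** transpose A\<close> by this
    identity and contracting with the first claim replaces \<open>H\<close> by
    \<open>transpose H\<close>, which is symmetry.\<close>
  have "transpose A = transpose (A ** H ** transpose A ** A)" by (simp add: *)
  then have **: "transpose A = transpose A ** A ** transpose H ** transpose A"
    by (simp add: matrix_transpose_mul matrix_mul_assoc)
  have "A ** H ** transpose A = A ** H ** transpose A ** A ** transpose H ** transpose A"
    by (metis ** matrix_mul_assoc)
  also have "\<dots> = A ** transpose H ** transpose A" by (simp add: *)
  finally show "transpose (A ** H ** transpose A) = A ** H ** transpose A"
    by (simp add: matrix_transpose_mul matrix_mul_assoc)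
qed

text \<open>The witness is \<open>A\<^sup>T G A H A\<^sup>T\<close> with arbitrary generalized inverses \<open>G\<close> of \<open>A A\<^sup>T\<close>
  and \<open>H\<close> of \<open>A\<^sup>T A\<close>.\<close>

lemma penrose_exists:
  fixes A :: "real^'d^'k"
  shows "\<exists>P. penrose A P"
proof -
  let ?B = "transpose A"
  obtain H where H: "?B ** A ** H ** (?B ** A) = ?B ** A"
    using generalized_inverse_exists by blast
  obtain G where G: "A ** ?B ** G ** (A ** ?B) = A ** ?B"
    using generalized_inverse_exists by blast
  note h = gram_generalized_inverse[OF H]
  \<comment> \<open>The same facts for \<open>transpose A\<close>, whose Gram matrix is
    \<open>A ** transpose A\<close>.\<close>
  have g: "?B ** G ** A ** ?B = ?B" "transpose (?B ** G ** A) = ?B ** G ** A"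
    using gram_generalized_inverse[of ?B G] G by simp_all
  have g': "A ** ?B ** transpose G ** A = A"
    using arg_cong[OF g(1), of transpose] by (simp add: matrix_transpose_mul matrix_mul_assoc)
  have g'': "?B ** transpose G ** A = ?B ** G ** A"
    using g(2) by (simp add: matrix_transpose_mul matrix_mul_assoc)
  have a: "A ** ?B ** G ** A = A"
    using g' g'' by (metis matrix_mul_assoc)
  define P where "P = ?B ** G ** A ** H ** ?B"
  \<comment> \<open>The two products are the orthogonal projections onto the column space and the
    row space of \<open>A\<close>, so their symmetry is already known from \<open>h\<close> and
    \<open>g\<close>.\<close>
  have AP: "A ** P = A ** H ** ?B"
    using a by (simp add: P_def matrix_mul_assoc)
  have PA: "P ** A = ?B ** G ** A"
    using h(1) unfolding P_def by (metis matrix_mul_assoc)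
  have "penrose A P"
    unfolding penrose_def AP PA
  proof (intro conjI)
    show "?B ** G ** A ** P = P"
      using g(1) by (simp add: P_def matrix_mul_assoc)
  qed (use h g in auto)
  then show ?thesis ..
qed

text \<open>\<open>A ** P\<close> and \<open>P ** A\<close> are the orthogonal projections onto the
  column and row space of \<open>A\<close>, so they are the same for every candidate, and
  \<open>P ** A ** P\<close> recovers \<open>P\<close> from them.\<close>

lemma penrose_unique:
  fixes A :: "real^'d^'k"
  assumes P: "penrose A P" and Q: "penrose A Q"
  shows "P = Q"
proof -
  \<comment> \<open>Insert \<open>A = A ** Q ** A\<close>; transposing then reverses the order of
    the two symmetric factors, and \<open>A ** P ** A\<close> collapses to \<open>A\<close>.\<close>
  have "A ** P = transpose (A ** Q ** A ** P)"
    using P Q by (simp add: penrose_def)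
  also have "\<dots> = transpose (A ** P) ** transpose (A ** Q)"
    by (simp flip: matrix_transpose_mul add: matrix_mul_assoc)
  also have "\<dots> = A ** Q"
    using P Q by (simp add: penrose_def matrix_mul_assoc)
  finally have AP: "A ** P = A ** Q" .
  have "P ** A = transpose (P ** (A ** Q ** A))"
    using P Q by (simp add: penrose_def)
  also have "\<dots> = transpose (Q ** A) ** transpose (P ** A)"
    by (simp flip: matrix_transpose_mul add: matrix_mul_assoc)
  also have "\<dots> = Q ** A"
    using P Q by (simp add: penrose_def) (metis matrix_mul_assoc)
  finally have PA: "P ** A = Q ** A" .
  have "P = P ** A ** P" using P by (simp add: penrose_def)
  also have "\<dots> = Q ** A ** Q" using AP PA by (metis matrix_mul_assoc)
  also have "\<dots> = Q" using Q by (simp add: penrose_def)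
  finally show ?thesis .
qed

lemma penrose_pinv: "penrose A (pinv A)"
proof -
  have "\<exists>!P. penrose A P" using penrose_exists penrose_unique by blast
  then show ?thesis
    unfolding pinv_def penrose_def by (rule theI')
qed

text \<open>Transpose \<open>A ** pinv A ** A = A\<close> and use the symmetry of
  \<open>A ** pinv A\<close>. Thus \<open>pinv A *v y\<close> solves the normal equations at any
  rank.\<close>

lemma pinv_normal_equation:
  fixes A :: "real^'d^'k"
  shows "transpose A ** A ** pinv A = transpose A"
proof -
  have "transpose A = transpose (A ** pinv A ** A)"
    using penrose_pinv[of A] by (simp add: penrose_def)
  also have "\<dots> = transpose A ** transpose (A ** pinv A)"
    by (simp add: matrix_transpose_mul)
  also have "\<dots> = transpose A ** A ** pinv A"
    using penrose_pinv[of A] by (simp add: penrose_def matrix_mul_assoc)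
  finally show ?thesis by simp
qed

text \<open>Among the solutions of singular normal equations, this range condition singles out the
  pseudoinverse; it drives the error bound for ridge solutions.\<close>

lemma pinv_in_range_gram:
  fixes A :: "real^'d^'k"
  shows "\<exists>Q. pinv A = transpose A ** A ** Q"
proof -
  let ?P = "pinv A"
  have "?P = transpose (?P ** A) ** ?P"
    using penrose_pinv[of A] by (simp add: penrose_def)
  also have "\<dots> = transpose A ** (transpose ?P ** ?P)"
    by (simp add: matrix_transpose_mul matrix_mul_assoc)
  also have "\<dots> = transpose A ** A ** (?P ** transpose ?P ** ?P)"
    by (subst pinv_normal_equation[symmetric]) (simp add: matrix_mul_assoc)
  finally show ?thesis ..
qed

text \<open>Cramer's rule in product form, applied to a solution of the normal equations. For a
  singular Gram matrix both sides are zero.\<close>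

lemma cramer_gram_pinv:
  fixes A :: "real^'d^'k" and y :: "real^'k"
  shows "det (\<chi> i j. if j = a then (transpose A *v y) $ i else (transpose A ** A) $ i $ j) =
    (pinv A *v y) $ a * det (transpose A ** A)"
  using cramer_lemma[where A="transpose A ** A" and k=a and x="pinv A *v y"]
  by (simp only: matrix_vector_mul_assoc[of "transpose A ** A" "pinv A"] pinv_normal_equation)

section \<open>Ridge regularization and its limit\<close>

lemma ridge_expand:
  fixes A :: "real^'d^'k"
  shows "(transpose A ** A + e *\<^sub>R mat 1) *v x = (transpose A ** A) *v x + e *\<^sub>R x"
  by (simp add: matrix_vector_mult_add_rdistrib scaleR_matrix_vector_assoc[symmetric])

text \<open>The quadratic form of the ridge matrix is at least e times the squared norm;
  Cauchy-Schwarz and division by \<open>norm x\<close> finish.\<close>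

lemma ridge_lower_bound:
  fixes A :: "real^'d^'k"
  assumes "0 < e"
  shows "e * norm x \<le> norm ((transpose A ** A + e *\<^sub>R mat 1) *v x)"
proof (cases "x = 0")
  case False
  let ?v = "(transpose A ** A + e *\<^sub>R mat 1) *v x"
  have "e * (norm x * norm x) \<le> (A *v x) \<bullet> (A *v x) + e * (x \<bullet> x)"
    by (simp add: dot_square_norm power2_eq_square)
  also have "\<dots> = x \<bullet> ?v"
    by (simp add: ridge_expand inner_add_right inner_gram)
  also have "\<dots> \<le> norm x * norm ?v"
    by (rule norm_cauchy_schwarz)
  finally show ?thesis using False
    by (simp add: mult.left_commute)
qed simp

text \<open>Cramer's formula for the solution of the ridge system. A quotient of determinants is
  visibly Borel in the entries.\<close>

definition ridge :: "real^'d^'k \<Rightarrow> real^'k \<Rightarrow> real \<Rightarrow> real^'d" where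
  "ridge A y e = (\<chi> a. det (\<chi> i j. if j = a then (transpose A *v y) $ i
       else (transpose A ** A + e *\<^sub>R mat 1) $ i $ j) / det (transpose A ** A + e *\<^sub>R mat 1))"

lemma ridge_solves:
  fixes A :: "real^'d^'k"
  assumes "0 < e"
  shows "(transpose A ** A + e *\<^sub>R mat 1) *v ridge A y e = transpose A *v y"
proof -
  have "det (transpose A ** A + e *\<^sub>R mat 1) \<noteq> 0"
  proof (rule pos_def_det_nonzero)
    fix x :: "real^'d" assume "x \<noteq> 0"
    then have "0 < (A *v x) \<bullet> (A *v x) + e * (x \<bullet> x)"
      using assms by (intro add_nonneg_pos) auto
    then show "0 < x \<bullet> ((transpose A ** A + e *\<^sub>R mat 1) *v x)"
      by (simp add: ridge_expand inner_add_right inner_gram)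
  qed
  from cramer[OF this, of "ridge A y e" "transpose A *v y"] show ?thesis by (simp add: ridge_def)
qed

text \<open>Writing the limit as the Gram matrix applied to a fixed vector \<open>?q\<close> gives
  an error of order e.\<close>

lemma ridge_tendsto_pinv:
  fixes A :: "real^'d^'k"
  shows "(\<lambda>n. ridge A y (1 / Suc n)) \<longlonglongrightarrow> pinv A *v y"
proof -
  obtain Q where "pinv A = transpose A ** A ** Q"
    using pinv_in_range_gram by blast
  then have q: "pinv A *v y = (transpose A ** A) *v (Q *v y)"
    by (simp add: matrix_vector_mul_assoc)
  let ?q = "Q *v y" and ?w = "pinv A *v y"
  have bound: "norm (ridge A y e - ?w) \<le> 2 * norm ?q * e" if e: "0 < e" for e
  proof -
    let ?R = "transpose A ** A + e *\<^sub>R mat 1"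
    \<comment> \<open>With the first-order term \<open>e *\<^sub>R ?q\<close> removed, the ridge
      matrix maps the error to a multiple of \<open>?q\<close> of size e squared, and
      \<open>ridge_lower_bound\<close> costs only one factor e.\<close>
    let ?d = "?w - ridge A y e - e *\<^sub>R ?q"
    have "?R *v ?w = transpose A *v y + e *\<^sub>R ?w"
      by (simp only: ridge_expand matrix_vector_mul_assoc[of "transpose A ** A" "pinv A"] pinv_normal_equation)
    moreover have "?R *v (e *\<^sub>R ?q) = e *\<^sub>R ?w + (e * e) *\<^sub>R ?q"
      by (simp add: ridge_expand matrix_vector_mult_scaleR q scaleR_add_right)
    ultimately have "?R *v ?d = - (e * e) *\<^sub>R ?q"
      by (simp add: matrix_vector_mult_diff_distrib ridge_solves[OF e])
    then have "e * norm ?d \<le> e * (e * norm ?q)"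
      using ridge_lower_bound[OF e, of ?d A] e by simp
    then have "norm ?d \<le> e * norm ?q" using e by simp
    moreover have "norm (ridge A y e - ?w) \<le> norm ?d + norm (e *\<^sub>R ?q)"
      using norm_triangle_ineq[of ?d "e *\<^sub>R ?q"] by (simp add: norm_minus_commute)
    ultimately show ?thesis using e by (simp add: mult.commute)
  qed
  have "(\<lambda>n. 2 * norm ?q * (1 / Suc n)) \<longlonglongrightarrow> 2 * norm ?q * 0"
    by (intro tendsto_intros LIMSEQ_Suc lim_1_over_n)
  then have lim: "(\<lambda>n. 2 * norm ?q * (1 / Suc n)) \<longlonglongrightarrow> 0" by (simp only: mult_zero_right)
  have "\<forall>\<^sub>F n in sequentially. norm (ridge A y (1 / Suc n) - ?w) \<le> 2 * norm ?q * (1 / Suc n)"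
    by (intro always_eventually allI bound) simp
  then have "(\<lambda>n. ridge A y (1 / Suc n) - ?w) \<longlonglongrightarrow> 0"
    using lim by (rule Lim_null_comparison)
  then show ?thesis by (rule LIM_zero_cancel)
qed

section \<open>Measurability of the least squares solution\<close>

lemma borel_measurable_cart_nth [measurable]:
  "(\<lambda>x :: real^'d. x $ i) \<in> borel_measurable borel"
  by (intro borel_measurable_continuous_onI continuous_intros)

lemma borel_measurable_cart_componentwise:
  fixes f :: "'a \<Rightarrow> real^'d"
  assumes "\<And>i. (\<lambda>x. f x $ i) \<in> borel_measurable M"
  shows "f \<in> borel_measurable M"
  using assms by (auto simp: borel_measurable_euclidean_space[of f] Basis_vec_def inner_axis)

lemma borel_measurable_det:
  fixes F :: "'a \<Rightarrow> real^'d^'d"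
  assumes [measurable]: "\<And>i j. (\<lambda>x. F x $ i $ j) \<in> borel_measurable M"
  shows "(\<lambda>x. det (F x)) \<in> borel_measurable M"
  unfolding det_def by measurable

lemma integrable_cart_componentwise:
  fixes f :: "'a \<Rightarrow> real^'d"
  assumes "\<And>i. integrable M (\<lambda>x. f x $ i)"
  shows "integrable M f"
proof -
  have "integrable M (\<lambda>x. \<Sum>i\<in>UNIV. (f x $ i) *\<^sub>R (axis i 1 :: real^'d))"
    using assms by (intro Bochner_Integration.integrable_sum integrable_scaleR_left) auto
  moreover have "(\<Sum>i\<in>UNIV. (f x $ i) *\<^sub>R (axis i 1 :: real^'d)) = f x" for x
    using basis_expansion[of "f x"] by (simp add: scalar_mult_eq_scaleR)
  ultimately show ?thesis by simp
qed

text \<open>Components may themselves be vectors, so that two applications reach the entries of a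
  matrix.\<close>

lemma integral_cart_nth:
  fixes f :: "'a \<Rightarrow> ('b::euclidean_space)^'d"
  assumes "integrable M f"
  shows "integral\<^sup>L M f $ i = (\<integral>x. f x $ i \<partial>M)"
  by (rule integral_bounded_linear[OF bounded_linear_vec_nth assms, symmetric])

lemma gram_design_nth:
  fixes xs :: "'k::finite \<Rightarrow> real^'d"
  shows "(transpose (design xs) ** design xs) $ i $ j = (\<Sum>l\<in>UNIV. xs l $ i * xs l $ j)"
  by (simp add: matrix_matrix_mult_def transpose_def design_def)

lemma transpose_design_mult_nth:
  fixes xs :: "'k::finite \<Rightarrow> real^'d"
  shows "(transpose (design xs) *v vec_lambda ys) $ i = (\<Sum>l\<in>UNIV. xs l $ i * ys l)"
  by (simp add: matrix_vector_mult_def transpose_def design_def)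

lemma borel_measurable_det_gram [measurable]:
  "(\<lambda>xs :: 'k::finite \<Rightarrow> real^'d. det (transpose (design xs) ** design xs)) \<in> borel_measurable (PiM UNIV (\<lambda>_. borel))"
  by (intro borel_measurable_det) (simp add: gram_design_nth)

text \<open>The pseudoinverse is discontinuous at rank-deficient matrices; as a pointwise limit of
  ridge solutions it is nevertheless Borel.\<close>

lemma borel_measurable_wstar_S [measurable]:
  "(\<lambda>(xs, ys). wstar_S xs ys) \<in> borel_measurable
    (PiM UNIV (\<lambda>_ :: 'k::finite. borel :: (real^'d) measure) \<Otimes>\<^sub>M PiM UNIV (\<lambda>_ :: 'k. borel :: real measure))"
proof (rule borel_measurable_LIMSEQ_metric)
  fix n :: nat
  let ?N = "PiM UNIV (\<lambda>_ :: 'k::finite. borel :: (real^'d) measure) \<Otimes>\<^sub>M PiM UNIV (\<lambda>_ :: 'k. borel :: real measure)"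
  have rhs: "(\<lambda>z. (transpose (design (fst z)) *v vec_lambda (snd z)) $ i) \<in> borel_measurable ?N" for i
    by (simp add: transpose_design_mult_nth)
  have mat: "(\<lambda>z. (transpose (design (fst z)) ** design (fst z) + (1 / Suc n) *\<^sub>R mat 1) $ i $ j) \<in> borel_measurable ?N" for i j
    by (simp add: gram_design_nth)
  have "(\<lambda>z. ridge (design (fst z)) (vec_lambda (snd z)) (1 / Suc n)) \<in> borel_measurable ?N"
  proof (rule borel_measurable_cart_componentwise)
    fix a
    show "(\<lambda>z. ridge (design (fst z)) (vec_lambda (snd z)) (1 / Suc n) $ a) \<in> borel_measurable ?N"
      unfolding ridge_def vec_lambda_beta
    proof (intro borel_measurable_divide borel_measurable_det mat)
      fix i j
      show "(\<lambda>z. (\<chi> i j. if j = a then (transpose (design (fst z)) *v vec_lambda (snd z)) $ i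
          else (transpose (design (fst z)) ** design (fst z) + (1 / Suc n) *\<^sub>R mat 1) $ i $ j) $ i $ j) \<in> borel_measurable ?N"
        by (cases "j = a") (simp_all only: vec_lambda_beta if_True if_False simp_thms rhs mat)
    qed
  qed
  then show "(\<lambda>(xs, ys). ridge (design xs) (vec_lambda ys) (1 / Suc n)) \<in> borel_measurable ?N"
    by (simp add: split_beta)
next
  fix z :: "('k \<Rightarrow> real^'d) \<times> ('k \<Rightarrow> real)"
  show "(\<lambda>n. case z of (xs, ys) \<Rightarrow> ridge (design xs) (\<chi> i. ys i) (1 / Suc n))
      \<longlonglongrightarrow> (case z of (xs, ys) \<Rightarrow> wstar_S xs ys)"
    by (simp add: split_beta wstar_S_def ridge_tendsto_pinv del: of_nat_Suc)
qed

section \<open>Two-stage sampling\<close>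

lemma emeasure_PiM_kernel:
  fixes K :: "'a \<Rightarrow> 'b measure" and xs :: "'k::finite \<Rightarrow> 'a"
  assumes "\<And>i. prob_space (K (xs i))" and "\<And>i. E i \<in> sets (K (xs i))"
  shows "emeasure (PiM UNIV (\<lambda>i. K (xs i))) (Pi\<^sub>E UNIV E) = (\<Prod>i\<in>UNIV. emeasure (K (xs i)) (E i))"
proof -
  interpret product_prob_space "\<lambda>i. K (xs i)" UNIV
    by (intro product_prob_spaceI assms)
  show ?thesis by (intro emeasure_PiM assms) auto
qed

text \<open>Boxes are an intersection-stable generator, and on a box the product measure is a finite
  product of functions measurable in \<open>xs\<close>.\<close>

lemma measurable_PiM_kernel:
  assumes K[measurable]: "K \<in> M \<rightarrow>\<^sub>M prob_algebra N"
  shows "(\<lambda>xs. PiM UNIV (\<lambda>i :: 'k::finite. K (xs i))) \<in> PiM UNIV (\<lambda>_. M) \<rightarrow>\<^sub>M prob_algebra (PiM UNIV (\<lambda>_. N))"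
proof (rule measurable_prob_algebra_generated)
  show "sets (PiM UNIV (\<lambda>_ :: 'k. N)) = sigma_sets (\<Pi>\<^sub>E i\<in>UNIV. space N) (prod_algebra UNIV (\<lambda>_. N))"
    by (rule sets_PiM)
  show "Int_stable (prod_algebra UNIV (\<lambda>_ :: 'k. N))"
    by (rule Int_stable_prod_algebra)
  show "prod_algebra UNIV (\<lambda>_ :: 'k. N) \<subseteq> Pow (\<Pi>\<^sub>E i\<in>UNIV. space N)"
    by (rule prod_algebra_sets_into_space)
  have kernel: "prob_space (K (xs i))" "sets (K (xs i)) = sets N"
    if "xs \<in> space (PiM UNIV (\<lambda>_ :: 'k. M))" for xs i
    using measurable_space[OF K, of "xs i"] that by (auto simp: space_PiM space_prob_algebra)
  fix xs assume xs: "xs \<in> space (PiM UNIV (\<lambda>_ :: 'k. M))"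
  show "prob_space (PiM UNIV (\<lambda>i. K (xs i)))"
    using kernel[OF xs] by (intro prob_space_PiM) auto
  show "sets (PiM UNIV (\<lambda>i. K (xs i))) = sets (PiM UNIV (\<lambda>_. N))"
    using kernel[OF xs] by (intro sets_PiM_cong) auto
next
  have kernel: "prob_space (K (xs i))" "sets (K (xs i)) = sets N"
    if "xs \<in> space (PiM UNIV (\<lambda>_ :: 'k. M))" for xs i
    using measurable_space[OF K, of "xs i"] that by (auto simp: space_PiM space_prob_algebra)
  fix A assume "A \<in> prod_algebra UNIV (\<lambda>_ :: 'k. N)"
  from prod_algebraE_all[OF this] obtain E
    where A: "A = Pi\<^sub>E UNIV E" and "E \<in> (\<Pi> i\<in>UNIV. sets N)" by blast
  then have E: "E i \<in> sets N" for i by auto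
  have eq: "emeasure (PiM UNIV (\<lambda>i. K (xs i))) A = (\<Prod>i\<in>UNIV. emeasure (K (xs i)) (E i))"
    if "xs \<in> space (PiM UNIV (\<lambda>_ :: 'k. M))" for xs
    unfolding A using kernel[OF that] E by (intro emeasure_PiM_kernel) auto
  have "(\<lambda>xs. emeasure (K (xs i)) (E i)) \<in> borel_measurable (PiM UNIV (\<lambda>_ :: 'k. M))" for i
    by (rule measurable_compose[OF _ measurable_emeasure_subprob_algebra[OF E]])
       (rule measurable_compose[OF _ measurable_prob_algebraD[OF K]], simp)
  then have "(\<lambda>xs. \<Prod>i\<in>UNIV. emeasure (K (xs i)) (E i)) \<in> borel_measurable (PiM UNIV (\<lambda>_ :: 'k. M))"
    by (intro borel_measurable_prod_ennreal)
  then show "(\<lambda>xs. emeasure (PiM UNIV (\<lambda>i. K (xs i))) A) \<in> borel_measurable (PiM UNIV (\<lambda>_ :: 'k. M))"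
    by (subst measurable_cong[OF eq])
qed

text \<open>Links i.i.d. pairs to the sample space of \<open>VS_D\<close>, where points and
  responses are stored apart.\<close>

definition unzip :: "('k \<Rightarrow> 'a \<times> 'b) \<Rightarrow> ('k \<Rightarrow> 'a) \<times> ('k \<Rightarrow> 'b)" where
  "unzip \<omega> = (\<lambda>i. fst (\<omega> i), \<lambda>i. snd (\<omega> i))"

text \<open>The distribution D is given by its marginal and a Markov kernel \<open>K\<close>, so the
  conditional law of y is defined at every point.\<close>

locale conditional_model =
  fixes DX :: "(real^'d) measure" and K :: "real^'d \<Rightarrow> real measure"
  assumes prob_DX: "prob_space DX"
    and sets_DX [measurable_cong]: "sets DX = sets borel"
    and K_measurable [measurable]: "K \<in> DX \<rightarrow>\<^sub>M prob_algebra borel"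
begin

lemma space_DX [simp]: "space DX = UNIV"
  using sets_eq_imp_space_eq[OF sets_DX] by simp

lemma prob_space_K: "prob_space (K x)" and sets_K [measurable_cong]: "sets (K x) = sets borel"
  using measurable_space[OF K_measurable, of x] by (auto simp: space_prob_algebra)

lemma space_K [simp]: "space (K x) = UNIV"
  using sets_eq_imp_space_eq[OF sets_K] by simp

lemma DX_in_prob_algebra: "DX \<in> space (prob_algebra DX)"
  by (simp add: space_prob_algebra prob_DX)

lemma joint_eq: "joint DX K = DX \<bind> (\<lambda>x. distr (K x) (borel \<Otimes>\<^sub>M borel) (Pair x))"
  unfolding joint_def
  by (intro bind_cong refl bind_return_distr') auto

lemma joint_kernel: "(\<lambda>x. distr (K x) (borel \<Otimes>\<^sub>M borel) (Pair x)) \<in> DX \<rightarrow>\<^sub>M prob_algebra (borel \<Otimes>\<^sub>M borel)"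
  by (rule measurable_distr_prob_space2[OF K_measurable]) measurable

lemma prob_space_joint: "prob_space (joint DX K)"
  unfolding joint_eq by (rule prob_space_bind'[OF DX_in_prob_algebra joint_kernel])

lemma sets_joint [measurable_cong]: "sets (joint DX K) = sets (borel \<Otimes>\<^sub>M borel)"
  unfolding joint_eq by (rule sets_bind'[OF DX_in_prob_algebra joint_kernel])

lemma space_joint [simp]: "space (joint DX K) = UNIV"
  using sets_eq_imp_space_eq[OF sets_joint] by (simp add: space_pair_measure)

lemma emeasure_joint:
  assumes [measurable]: "A \<in> sets (borel \<Otimes>\<^sub>M borel)"
  shows "emeasure (joint DX K) A = (\<integral>\<^sup>+x. emeasure (K x) (Pair x -` A) \<partial>DX)"
  unfolding joint_eq
  by (subst emeasure_bind_prob_algebra[OF DX_in_prob_algebra joint_kernel])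
     (auto intro!: nn_integral_cong simp: emeasure_distr)

lemma measurable_emeasure_section:
  assumes [measurable]: "A \<in> sets (borel \<Otimes>\<^sub>M borel)"
  shows "(\<lambda>x. emeasure (K x) (Pair x -` A)) \<in> borel_measurable DX"
proof -
  have "(\<lambda>x. emeasure (distr (K x) (borel \<Otimes>\<^sub>M borel) (Pair x)) A) \<in> borel_measurable DX"
    by (rule measurable_compose[OF measurable_prob_algebraD[OF joint_kernel] measurable_emeasure_subprob_algebra]) simp
  then show ?thesis by (simp add: emeasure_distr)
qed

text \<open>Each \<open>K x\<close> has mass one, so forgetting y restores \<open>DX\<close>.
  Moments of x can therefore be taken under the joint law.\<close>

lemma distr_joint_fst: "distr (joint DX K) DX fst = DX"
proof (rule measure_eqI)
  fix A assume "A \<in> sets (distr (joint DX K) DX fst)"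
  then have [measurable]: "A \<in> sets borel" by (simp add: sets_DX)
  have "emeasure (distr (joint DX K) DX fst) A = emeasure (joint DX K) (A \<times> UNIV)"
    by (subst emeasure_distr) (auto simp: sets_DX intro!: arg_cong[where f="emeasure (joint DX K)"])
  also have "\<dots> = (\<integral>\<^sup>+x. emeasure (K x) (Pair x -` (A \<times> UNIV)) \<partial>DX)"
    by (rule emeasure_joint) simp
  also have "\<dots> = (\<integral>\<^sup>+x. indicator A x \<partial>DX)"
    using prob_space.emeasure_space_1[OF prob_space_K]
    by (intro nn_integral_cong) (auto simp: indicator_def)
  also have "\<dots> = emeasure DX A" by (simp add: sets_DX)
  finally show "emeasure (distr (joint DX K) DX fst) A = emeasure DX A" .
qed simp

text \<open>The second stage of \<open>VS_D\<close>, isolated so that it can also follow an i.i.d.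
  design.\<close>

definition sample_kernel :: "('k::finite \<Rightarrow> real^'d) \<Rightarrow> (('k \<Rightarrow> real^'d) \<times> ('k \<Rightarrow> real)) measure" where
  "sample_kernel xs = distr (PiM UNIV (\<lambda>i. K (xs i)))
     (PiM UNIV (\<lambda>_. borel) \<Otimes>\<^sub>M PiM UNIV (\<lambda>_. borel)) (Pair xs)"

lemma sample_kernel_measurable:
  "sample_kernel \<in> PiM UNIV (\<lambda>_ :: 'k::finite. DX) \<rightarrow>\<^sub>M prob_algebra (PiM UNIV (\<lambda>_. borel) \<Otimes>\<^sub>M PiM UNIV (\<lambda>_. borel))"
  unfolding sample_kernel_def
  by (rule measurable_distr_prob_space2[OF measurable_PiM_kernel[OF K_measurable]]) measurable

lemma measurable_Pair_sample:
  fixes xs :: "'k::finite \<Rightarrow> real^'d"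
  shows "Pair xs \<in> PiM UNIV (\<lambda>i. K (xs i)) \<rightarrow>\<^sub>M PiM UNIV (\<lambda>_ :: 'k. borel) \<Otimes>\<^sub>M PiM UNIV (\<lambda>_ :: 'k. borel)"
  by (intro measurable_Pair measurable_const)
     (auto simp: space_PiM sets_K cong: measurable_cong_sets sets_PiM_cong)

lemma emeasure_sample_kernel:
  fixes xs :: "'k::finite \<Rightarrow> real^'d"
  assumes "B \<in> sets (PiM UNIV (\<lambda>_ :: 'k. borel) \<Otimes>\<^sub>M PiM UNIV (\<lambda>_ :: 'k. borel))"
  shows "emeasure (sample_kernel xs) B = emeasure (PiM UNIV (\<lambda>i. K (xs i))) (Pair xs -` B)"
  using assms measurable_Pair_sample by (simp add: sample_kernel_def emeasure_distr space_PiM)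

lemma iid_design_in_prob_algebra:
  "PiM UNIV (\<lambda>_ :: 'k::finite. DX) \<in> space (prob_algebra (PiM UNIV (\<lambda>_ :: 'k. DX)))"
  by (simp add: space_prob_algebra prob_space_PiM prob_DX)

lemma unzip_measurable:
  "unzip \<in> PiM UNIV (\<lambda>_ :: 'k::finite. joint DX K) \<rightarrow>\<^sub>M PiM UNIV (\<lambda>_. borel) \<Otimes>\<^sub>M PiM UNIV (\<lambda>_. borel)"
  unfolding unzip_def
  by (intro measurable_Pair measurable_PiM_single') (auto simp: space_PiM)

text \<open>Drawing all points first and then all responses amounts to drawing independent pairs: on
  boxes both laws factor over the sample index.\<close>

lemma iid_sample_two_stage:
  "distr (PiM UNIV (\<lambda>_ :: 'k::finite. joint DX K)) (PiM UNIV (\<lambda>_. borel) \<Otimes>\<^sub>M PiM UNIV (\<lambda>_. borel)) unzip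
    = PiM UNIV (\<lambda>_ :: 'k. DX) \<bind> sample_kernel" (is "distr ?J ?N unzip = ?Q")
proof -
  \<comment> \<open>The inverse of \<open>unzip\<close>; it moves the comparison to a product space,
    where boxes determine the measure.\<close>
  define Z :: "('k \<Rightarrow> real^'d) \<times> ('k \<Rightarrow> real) \<Rightarrow> 'k \<Rightarrow> (real^'d) \<times> real"
    where "Z = (\<lambda>z i. (fst z i, snd z i))"
  have Z [measurable]: "Z \<in> ?N \<rightarrow>\<^sub>M PiM UNIV (\<lambda>_. borel \<Otimes>\<^sub>M borel)"
    unfolding Z_def by (rule measurable_PiM_single') (auto simp: space_pair_measure space_PiM)
  have sets_Q [measurable_cong]: "sets ?Q = sets ?N"
    by (rule sets_bind'[OF iid_design_in_prob_algebra sample_kernel_measurable])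
  have sets_J [measurable_cong]: "sets ?J = sets (PiM UNIV (\<lambda>_ :: 'k. borel \<Otimes>\<^sub>M borel))"
    by (intro sets_PiM_cong sets_joint refl)
  interpret J: product_prob_space "\<lambda>_ :: 'k. joint DX K" UNIV
    by (intro product_prob_spaceI prob_space_joint)
  interpret X: product_prob_space "\<lambda>_ :: 'k. DX" UNIV
    by (intro product_prob_spaceI prob_DX)
  have "distr ?Q ?J Z = ?J"
  proof (rule J.PiM_eqI)
    fix A :: "'k \<Rightarrow> ((real^'d) \<times> real) set"
    assume "\<And>i. i \<in> UNIV \<Longrightarrow> A i \<in> sets (joint DX K)"
    then have A [measurable]: "A i \<in> sets (borel \<Otimes>\<^sub>M borel)" for i by (simp add: sets_joint)
    have box: "Pi\<^sub>E UNIV A \<in> sets ?J" by (intro sets_PiM_I_finite) (auto simp: sets_joint)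
    have pre: "Z -` Pi\<^sub>E UNIV A \<in> sets ?N"
      using measurable_sets[OF Z, of "Pi\<^sub>E UNIV A"] box sets_J by (simp add: space_pair_measure space_PiM)
    have "emeasure (distr ?Q ?J Z) (Pi\<^sub>E UNIV A) = emeasure ?Q (Z -` Pi\<^sub>E UNIV A)"
      using box sets_eq_imp_space_eq[OF sets_Q] by (subst emeasure_distr) (auto simp: space_pair_measure space_PiM)
    also have "\<dots> = (\<integral>\<^sup>+xs. emeasure (sample_kernel xs) (Z -` Pi\<^sub>E UNIV A) \<partial>PiM UNIV (\<lambda>_ :: 'k. DX))"
      by (rule emeasure_bind_prob_algebra[OF iid_design_in_prob_algebra sample_kernel_measurable pre])
    also have "\<dots> = (\<integral>\<^sup>+xs. (\<Prod>i\<in>UNIV. emeasure (K (xs i)) (Pair (xs i) -` A i)) \<partial>PiM UNIV (\<lambda>_ :: 'k. DX))"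
    \<comment> \<open>For fixed points, the section of a box of pairs is a box of responses.\<close>
    proof (rule nn_integral_cong)
      fix xs :: "'k \<Rightarrow> real^'d"
      have "Pair xs -` Z -` Pi\<^sub>E UNIV A = Pi\<^sub>E UNIV (\<lambda>i. Pair (xs i) -` A i)"
        by (auto simp: Z_def PiE_iff)
      then show "emeasure (sample_kernel xs) (Z -` Pi\<^sub>E UNIV A) = (\<Prod>i\<in>UNIV. emeasure (K (xs i)) (Pair (xs i) -` A i))"
        using pre by (simp add: emeasure_sample_kernel emeasure_PiM_kernel prob_space_K sets_K sets_Pair1)
    qed
    also have "\<dots> = (\<Prod>i\<in>UNIV. \<integral>\<^sup>+x. emeasure (K x) (Pair x -` A i) \<partial>DX)"
      by (rule X.product_nn_integral_prod) (auto intro: measurable_emeasure_section)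
    also have "\<dots> = (\<Prod>i\<in>UNIV. emeasure (joint DX K) (A i))"
      by (simp add: emeasure_joint)
    finally show "emeasure (distr ?Q ?J Z) (Pi\<^sub>E UNIV A) = (\<Prod>i\<in>UNIV. emeasure (joint DX K) (A i))" .
  qed auto
  \<comment> \<open>Going back along \<open>unzip\<close> undoes \<open>Z\<close>.\<close>
  then have "distr ?J ?N unzip = distr (distr ?Q ?J Z) ?N unzip" by simp
  also have "\<dots> = distr ?Q ?N (unzip \<circ> Z)"
    by (rule distr_distr[OF unzip_measurable]) measurable
  also have "unzip \<circ> Z = (\<lambda>z. z)"
    by (auto simp: unzip_def Z_def fun_eq_iff)
  also have "distr ?Q ?N (\<lambda>z. z) = ?Q"
    using sets_Q by (intro distr_id2) simp
  finally show ?thesis .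
qed

end

section \<open>Expected determinants of i.i.d. sums\<close>

lemma prod_inj_eq_prod_all:
  fixes f :: "'d::finite \<Rightarrow> 'k::finite" and h :: "'d \<Rightarrow> 'k \<Rightarrow> real"
  assumes "inj f"
  shows "(\<Prod>r\<in>UNIV. h r (f r)) = (\<Prod>i\<in>UNIV. if i \<in> range f then h (inv f i) i else 1)"
proof -
  have "(\<Prod>i\<in>UNIV. if i \<in> range f then h (inv f i) i else 1) = (\<Prod>i\<in>range f. h (inv f i) i)"
    by (simp add: prod.If_cases)
  also have "\<dots> = (\<Prod>r\<in>UNIV. h r (f r))"
    using assms by (simp add: prod.reindex)
  finally show ?thesis by simp
qed

text \<open>Injectivity means that no sample point is used twice, so the factors are independent and
  integrability of each one suffices.\<close>

lemma (in prob_space) integral_iid_prod_inj: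
  fixes f :: "'d::finite \<Rightarrow> 'k::finite" and \<phi> :: "'d \<Rightarrow> 'a \<Rightarrow> real"
  assumes f: "inj f" and \<phi>: "\<And>r. integrable M (\<phi> r)"
  shows "integrable (PiM UNIV (\<lambda>_ :: 'k. M)) (\<lambda>\<omega>. \<Prod>r\<in>UNIV. \<phi> r (\<omega> (f r)))"
    and "(\<integral>\<omega>. (\<Prod>r\<in>UNIV. \<phi> r (\<omega> (f r))) \<partial>PiM UNIV (\<lambda>_ :: 'k. M)) = (\<Prod>r\<in>UNIV. integral\<^sup>L M (\<phi> r))"
proof -
  interpret P: product_prob_space "\<lambda>_ :: 'k. M" UNIV
    by (intro product_prob_spaceI prob_space_axioms)
  \<comment> \<open>Sample indices missed by \<open>f\<close> get the constant 1, whose integral is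
    1 under a probability measure.\<close>
  define \<psi> where "\<psi> i = (if i \<in> range f then \<phi> (inv f i) else (\<lambda>_. 1))" for i
  have \<psi>: "integrable M (\<psi> i)" for i
    using \<phi> by (simp add: \<psi>_def)
  have eq: "(\<Prod>r\<in>UNIV. \<phi> r (\<omega> (f r))) = (\<Prod>i\<in>UNIV. \<psi> i (\<omega> i))" for \<omega>
    using prod_inj_eq_prod_all[OF f, of "\<lambda>r i. \<phi> r (\<omega> i)"] by (simp add: \<psi>_def if_distrib[of "\<lambda>g. g _"] cong: if_cong)
  show "integrable (PiM UNIV (\<lambda>_ :: 'k. M)) (\<lambda>\<omega>. \<Prod>r\<in>UNIV. \<phi> r (\<omega> (f r)))"
    unfolding eq by (intro P.product_integrable_prod \<psi>) simp
  have "(\<integral>\<omega>. (\<Prod>r\<in>UNIV. \<phi> r (\<omega> (f r))) \<partial>PiM UNIV (\<lambda>_ :: 'k. M)) = (\<Prod>i\<in>UNIV. integral\<^sup>L M (\<psi> i))"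
    unfolding eq by (intro P.product_integral_prod \<psi>) simp
  also have "\<dots> = (\<Prod>i\<in>UNIV. if i \<in> range f then integral\<^sup>L M (\<phi> (inv f i)) else 1)"
    by (intro prod.cong refl) (simp add: \<psi>_def prob_space)
  also have "\<dots> = (\<Prod>r\<in>UNIV. integral\<^sup>L M (\<phi> r))"
    using prod_inj_eq_prod_all[OF f, of "\<lambda>r i. integral\<^sup>L M (\<phi> r)"] by simp
  finally show "(\<integral>\<omega>. (\<Prod>r\<in>UNIV. \<phi> r (\<omega> (f r))) \<partial>PiM UNIV (\<lambda>_ :: 'k. M)) = (\<Prod>r\<in>UNIV. integral\<^sup>L M (\<phi> r))" .
qed

text \<open>Every injection contributes the determinant of the expected matrix, so the expectation
  is that determinant times the number of injections.\<close>

lemma (in prob_space) expectation_det_sum_iid: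
  fixes u v :: "'a \<Rightarrow> 'd::finite \<Rightarrow> real"
  assumes uv: "\<And>r c. integrable M (\<lambda>z. u z r * v z c)"
    and card: "CARD('d) \<le> CARD('k::finite)"
  shows "integrable (PiM UNIV (\<lambda>_ :: 'k. M)) (\<lambda>\<omega>. det (\<chi> r c. \<Sum>i\<in>UNIV. u (\<omega> i) r * v (\<omega> i) c))"
    and "(\<integral>\<omega>. det (\<chi> r c. \<Sum>i\<in>UNIV. u (\<omega> i) r * v (\<omega> i) c) \<partial>PiM UNIV (\<lambda>_ :: 'k. M))
      = fact CARD('d) * real (CARD('k) choose CARD('d)) * det (\<chi> r c. \<integral>z. u z r * v z c \<partial>M)"
proof -
  let ?P = "PiM UNIV (\<lambda>_ :: 'k. M)"
  note summand = integral_iid_prod_inj[where 'k='k and \<phi>="\<lambda>r z. u z r * v z (p r)" for p, OF _ uv]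
  note expand = det_sum_outer_products[of "\<lambda>i. u (\<omega> i)" "\<lambda>i. v (\<omega> i)" for \<omega> :: "'k \<Rightarrow> 'a"]
  show "integrable ?P (\<lambda>\<omega>. det (\<chi> r c. \<Sum>i\<in>UNIV. u (\<omega> i) r * v (\<omega> i) c))"
    unfolding expand
    by (intro Bochner_Integration.integrable_sum integrable_mult_right summand(1)) simp
  have "(\<integral>\<omega>. det (\<chi> r c. \<Sum>i\<in>UNIV. u (\<omega> i) r * v (\<omega> i) c) \<partial>?P)
    = (\<Sum>f | inj (f :: 'd \<Rightarrow> 'k). \<Sum>p | p permutes UNIV. of_int (sign p) *
        (\<integral>\<omega>. (\<Prod>r\<in>UNIV. u (\<omega> (f r)) r * v (\<omega> (f r)) (p r)) \<partial>?P))"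
    unfolding expand
    by (subst Bochner_Integration.integral_sum,
        intro Bochner_Integration.integrable_sum integrable_mult_right summand(1), simp,
        intro sum.cong refl, subst Bochner_Integration.integral_sum,
        intro integrable_mult_right summand(1)) simp_all
  \<comment> \<open>By independence and identical laws the integral no longer depends on
    \<open>f\<close>; the sum over permutations is the Leibniz formula.\<close>
  also have "\<dots> = (\<Sum>f | inj (f :: 'd \<Rightarrow> 'k). det (\<chi> r c. \<integral>z. u z r * v z c \<partial>M))"
    by (intro sum.cong refl) (simp add: summand(2) det_def)
  also have "\<dots> = fact CARD('d) * real (CARD('k) choose CARD('d)) * det (\<chi> r c. \<integral>z. u z r * v z c \<partial>M)"
    using card_inj_functions[OF card] by simp
  finally show "(\<integral>\<omega>. det (\<chi> r c. \<Sum>i\<in>UNIV. u (\<omega> i) r * v (\<omega> i) c) \<partial>?P)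
      = fact CARD('d) * real (CARD('k) choose CARD('d)) * det (\<chi> r c. \<integral>z. u z r * v z c \<partial>M)" .
qed

section \<open>Volume sampling as a reweighted i.i.d. sample\<close>

context conditional_model
begin

text \<open>The weight depends on the design only, so weighting before or after drawing the
  responses gives the same law.\<close>

lemma VS_D_eq_density:
  "(VS_D DX K :: (('k::finite \<Rightarrow> real^'d) \<times> ('k \<Rightarrow> real)) measure) =
    density (distr (PiM UNIV (\<lambda>_ :: 'k. joint DX K)) (PiM UNIV (\<lambda>_. borel) \<Otimes>\<^sub>M PiM UNIV (\<lambda>_. borel)) unzip)
     (\<lambda>z. ennreal (det (transpose (design (fst z)) ** design (fst z))
        / (fact CARD('d) * real (CARD('k) choose CARD('d)) * det (Sigma DX))))"
    (is "_ = density _ (\<lambda>z. ?g (fst z))")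
proof -
  let ?N = "PiM UNIV (\<lambda>_ :: 'k. borel :: (real^'d) measure) \<Otimes>\<^sub>M PiM UNIV (\<lambda>_ :: 'k. borel :: real measure)"
  let ?P = "PiM UNIV (\<lambda>_ :: 'k. DX)"
  let ?Q = "?P \<bind> sample_kernel"
  have sets_P [measurable_cong]: "sets ?P = sets (PiM UNIV (\<lambda>_ :: 'k. borel))"
    by (intro sets_PiM_cong sets_DX refl)
  have g [measurable]: "?g \<in> borel_measurable ?P" by measurable
  have kernel: "sample_kernel \<in> ?P \<rightarrow>\<^sub>M subprob_algebra ?N"
    by (rule measurable_prob_algebraD[OF sample_kernel_measurable])
  then have kernel': "sample_kernel \<in> density ?P ?g \<rightarrow>\<^sub>M subprob_algebra ?N" by simp
  have VS: "VS_D DX K = density ?P ?g \<bind> sample_kernel"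
    by (simp add: VS_D_def VS_X_def sample_kernel_def[abs_def])
  have sets_Q [measurable_cong]: "sets ?Q = sets ?N"
    by (rule sets_bind'[OF iid_design_in_prob_algebra sample_kernel_measurable])
  have "density ?P ?g \<bind> sample_kernel = density ?Q (\<lambda>z. ?g (fst z))"
  proof (rule measure_eqI)
    show "sets (density ?P ?g \<bind> sample_kernel) = sets (density ?Q (\<lambda>z. ?g (fst z)))"
      using sets_bind_measurable[OF kernel'] by (simp add: sets_Q space_PiM)
    fix A assume "A \<in> sets (density ?P ?g \<bind> sample_kernel)"
    then have A [measurable]: "A \<in> sets ?N"
      using sets_bind_measurable[OF kernel'] by (simp add: space_PiM)
    have "emeasure (density ?P ?g \<bind> sample_kernel) A = (\<integral>\<^sup>+xs. emeasure (sample_kernel xs) A \<partial>density ?P ?g)"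
      by (rule emeasure_bind[OF _ kernel' A]) (simp add: space_PiM)
    also have "\<dots> = (\<integral>\<^sup>+xs. ?g xs * emeasure (sample_kernel xs) A \<partial>?P)"
      by (rule nn_integral_density[OF g measurable_compose[OF kernel measurable_emeasure_subprob_algebra[OF A]]])
    also have "\<dots> = (\<integral>\<^sup>+xs. \<integral>\<^sup>+z. ?g (fst z) * indicator A z \<partial>sample_kernel xs \<partial>?P)"
    \<comment> \<open>Under \<open>sample_kernel xs\<close> the first component is the constant
      \<open>xs\<close>, so the weight leaves the inner integral.\<close>
    proof (rule nn_integral_cong)
      fix xs :: "'k \<Rightarrow> real^'d"
      have Pair [measurable]: "Pair xs \<in> PiM UNIV (\<lambda>i. K (xs i)) \<rightarrow>\<^sub>M ?N"
        by (rule measurable_Pair_sample)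
      have "(\<integral>\<^sup>+z. ?g (fst z) * indicator A z \<partial>sample_kernel xs)
          = (\<integral>\<^sup>+z. ?g xs * indicator A z \<partial>sample_kernel xs)"
        by (simp add: sample_kernel_def nn_integral_distr)
      also have "\<dots> = ?g xs * emeasure (sample_kernel xs) A"
        by (rule nn_integral_cmult_indicator) (simp add: sample_kernel_def)
      finally show "?g xs * emeasure (sample_kernel xs) A = (\<integral>\<^sup>+z. ?g (fst z) * indicator A z \<partial>sample_kernel xs)" by simp
    qed
    also have "\<dots> = (\<integral>\<^sup>+z. ?g (fst z) * indicator A z \<partial>?Q)"
      by (rule nn_integral_bind[OF _ kernel, symmetric]) measurable
    also have "\<dots> = emeasure (density ?Q (\<lambda>z. ?g (fst z))) A"
      by (rule emeasure_density[symmetric]) measurable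
    finally show "emeasure (density ?P ?g \<bind> sample_kernel) A = emeasure (density ?Q (\<lambda>z. ?g (fst z))) A" .
  qed
  then show ?thesis
    unfolding VS iid_sample_two_stage .
qed

end

section \<open>Second moments and unbiasedness\<close>

locale square_integrable_model = conditional_model DX K
  for DX :: "(real^'d) measure" and K :: "real^'d \<Rightarrow> real measure" +
  assumes x_sq: "integrable (joint DX K) (\<lambda>(x, y). (norm x)\<^sup>2)"
    and y_sq: "integrable (joint DX K) (\<lambda>(x, y). y\<^sup>2)"
begin

lemma integrable_xx: "integrable (joint DX K) (\<lambda>z. fst z $ i * fst z $ j)"
proof (rule Bochner_Integration.integrable_bound[OF x_sq])
  show "AE z in joint DX K. norm (fst z $ i * fst z $ j) \<le> norm (case z of (x, y) \<Rightarrow> (norm x)\<^sup>2)"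
    by (auto intro!: AE_I2 simp: abs_mult power2_eq_square split_beta mult_mono component_le_norm_cart)
qed measurable

lemma integrable_xy: "integrable (joint DX K) (\<lambda>z. fst z $ i * snd z)"
proof (rule Bochner_Integration.integrable_bound[OF Bochner_Integration.integrable_add[OF x_sq y_sq]])
  have "\<bar>x $ i * y\<bar> \<le> (norm x)\<^sup>2 + y\<^sup>2" for x :: "real^'d" and y :: real
  proof -
    have "\<bar>x $ i * y\<bar> \<le> norm x * \<bar>y\<bar>"
      by (simp add: abs_mult mult_right_mono component_le_norm_cart)
    also have "\<dots> \<le> (norm x)\<^sup>2 + \<bar>y\<bar>\<^sup>2"
    proof -
      have "2 * (norm x * \<bar>y\<bar>) \<le> (norm x)\<^sup>2 + \<bar>y\<bar>\<^sup>2"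
        using sum_squares_bound[of "norm x" "\<bar>y\<bar>"] by (simp only: mult.assoc)
      moreover have "0 \<le> norm x * \<bar>y\<bar>" by simp
      ultimately show ?thesis by linarith
    qed
    finally show ?thesis by simp
  qed
  then show "AE z in joint DX K. norm (fst z $ i * snd z) \<le> norm ((case z of (x, y) \<Rightarrow> (norm x)\<^sup>2) + (case z of (x, y) \<Rightarrow> y\<^sup>2))"
    by (auto intro!: AE_I2 simp: split_beta)
qed measurable

text \<open>Puts the second moments of x under the same law as those of x and y, the setting of
  \<open>expectation_det_sum_iid\<close>.\<close>

lemma Sigma_nth: "Sigma DX $ i $ j = (\<integral>z. fst z $ i * fst z $ j \<partial>joint DX K)"
proof -
  have sum_if: "(\<Sum>l\<in>UNIV. if P then h l else 0) = (if P then \<Sum>l\<in>UNIV. h l else 0)" for P and h :: "'d \<Rightarrow> real"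
    by simp
  \<comment> \<open>Expansion in matrix units reduces integrability and measurability of
    \<open>outer\<close> to scalar entries.\<close>
  have outer_eq: "outer x = (\<Sum>i\<in>UNIV. \<Sum>j\<in>UNIV. (x $ i * x $ j) *\<^sub>R axis i (axis j 1))" for x :: "real^'d"
    by (simp add: vec_eq_iff outer_def axis_def if_distrib[of "\<lambda>v. v $ _"] if_distrib[of "\<lambda>t. _ * t"] sum_if sum.delta cong: if_cong)
  have int: "integrable (joint DX K) (\<lambda>z. outer (fst z))"
    unfolding outer_eq by (intro Bochner_Integration.integrable_sum integrable_scaleR_left integrable_xx)
  have [measurable]: "(outer :: real^'d \<Rightarrow> _) \<in> borel_measurable borel"
    unfolding outer_eq by measurable
  have "Sigma DX = integral\<^sup>L (distr (joint DX K) DX fst) outer"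
    by (simp add: Sigma_def distr_joint_fst)
  also have "\<dots> = (\<integral>z. outer (fst z) \<partial>joint DX K)"
    by (rule integral_distr) measurable
  finally have "Sigma DX $ i $ j = (\<integral>z. outer (fst z) $ i \<partial>joint DX K) $ j"
    by (simp add: integral_cart_nth[OF int])
  also have "\<dots> = (\<integral>z. outer (fst z) $ i $ j \<partial>joint DX K)"
    by (rule integral_cart_nth) (rule integrable_bounded_linear[OF bounded_linear_vec_nth int])
  finally show ?thesis by (simp add: outer_def)
qed

text \<open>The quadratic form is the expected square of the inner product of the fixed vector with
  the random point.\<close>

lemma Sigma_pos_semidef: "0 \<le> x \<bullet> (Sigma DX *v x)"
proof -
  have "x \<bullet> (Sigma DX *v x) = (\<Sum>i\<in>UNIV. \<Sum>j\<in>UNIV. (\<integral>z. (x $ i * x $ j) * (fst z $ i * fst z $ j) \<partial>joint DX K))"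
    by (simp add: inner_vec_def matrix_vector_mult_def Sigma_nth sum_distrib_left mult_ac)
  also have "\<dots> = (\<integral>z. (\<Sum>i\<in>UNIV. \<Sum>j\<in>UNIV. (x $ i * x $ j) * (fst z $ i * fst z $ j)) \<partial>joint DX K)"
    by (simp add: integrable_xx)
  also have "\<dots> = (\<integral>z. (x \<bullet> fst z)\<^sup>2 \<partial>joint DX K)"
    by (simp add: inner_vec_def power2_eq_square sum_product mult_ac)
  also have "\<dots> \<ge> 0" by simp
  finally show ?thesis .
qed

lemma cross_moment_nth:
  "integral\<^sup>L (joint DX K) (\<lambda>(x, y). y *\<^sub>R x) $ i = (\<integral>z. fst z $ i * snd z \<partial>joint DX K)"
proof -
  have "integrable (joint DX K) (\<lambda>(x, y). y *\<^sub>R x)"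
    by (rule integrable_cart_componentwise) (use integrable_xy in \<open>simp add: split_beta mult.commute\<close>)
  from integral_cart_nth[OF this, of i] show ?thesis
    by (simp add: split_beta mult.commute)
qed

end

theorem theorem2:
  fixes DX :: "(real^'d) measure"
    and K :: "real^'d \<Rightarrow> real measure"
  assumes "prob_space DX" and "sets DX = sets borel"
    and "K \<in> DX \<rightarrow>\<^sub>M prob_algebra borel"
    and "integrable (joint DX K) (\<lambda>(x, y). (norm x)\<^sup>2)"
    and "integrable (joint DX K) (\<lambda>(x, y). y\<^sup>2)"
    and "invertible (Sigma DX)"
    and "CARD('k::finite) \<ge> CARD('d)"
  shows "integrable (VS_D DX K :: (('k \<Rightarrow> real^'d) \<times> ('k \<Rightarrow> real)) measure)
            (\<lambda>(xs, ys). wstar_S xs ys)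
       \<and> integral\<^sup>L (VS_D DX K :: (('k \<Rightarrow> real^'d) \<times> ('k \<Rightarrow> real)) measure)
            (\<lambda>(xs, ys). wstar_S xs ys) = wstar_D DX K"
proof -
  interpret square_integrable_model DX K
    by (intro square_integrable_model.intro conditional_model.intro square_integrable_model_axioms.intro assms)
  interpret J: prob_space "joint DX K" by (rule prob_space_joint)
  let ?N = "PiM UNIV (\<lambda>_ :: 'k. borel :: (real^'d) measure) \<Otimes>\<^sub>M PiM UNIV (\<lambda>_ :: 'k. borel :: real measure)"
  let ?P = "PiM UNIV (\<lambda>_ :: 'k. joint DX K)"
  let ?M = "distr ?P ?N unzip"
  let ?b = "integral\<^sup>L (joint DX K) (\<lambda>(x, y). y *\<^sub>R x)"
  define C where "C = fact CARD('d) * real (CARD('k) choose CARD('d))"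
  define g where "g xs = det (transpose (design xs) ** design xs) / (C * det (Sigma DX))" for xs :: "'k \<Rightarrow> real^'d"
  define w where "w = (\<lambda>(xs :: 'k \<Rightarrow> real^'d, ys :: 'k \<Rightarrow> real). wstar_S xs ys)"
  have C: "C > 0" using assms(7) by (simp add: C_def)
  have det_Sigma: "det (Sigma DX) > 0"
    using pos_semidef_det_nonneg[OF Sigma_pos_semidef] assms(6) by (simp add: invertible_det_nz)
  \<comment> \<open>Nonnegativity ensures that \<open>ennreal\<close> does not truncate the weight,
    so integrals against the density become real weighted integrals.\<close>
  have g_nonneg: "0 \<le> g xs" for xs
    using C det_Sigma pos_semidef_det_nonneg[of "transpose (design xs) ** design xs"]
    by (simp add: g_def inner_gram)
  have VS: "VS_D DX K = density ?M (\<lambda>z. ennreal (g (fst z)))"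
    unfolding g_def C_def by (rule VS_D_eq_density)
  have g_meas [measurable]: "g \<in> borel_measurable (PiM UNIV (\<lambda>_. borel))"
    unfolding g_def by measurable
  have w_meas [measurable]: "w \<in> borel_measurable ?N"
    unfolding w_def by (rule borel_measurable_wstar_S)
  have unzip [measurable]: "unzip \<in> ?P \<rightarrow>\<^sub>M ?N" by (rule unzip_measurable)

  \<comment> \<open>The point with coordinate \<open>a\<close> replaced by its response: summed
    against the points, it produces the numerator matrix in Cramer's rule.\<close>
  define v where "v a = (\<lambda>z :: (real^'d) \<times> real. \<lambda>c. if c = a then snd z else fst z $ c)" for a
  have uv: "integrable (joint DX K) (\<lambda>z. fst z $ r * v a z c)" for a r c
    by (cases "c = a") (simp_all add: v_def integrable_xx integrable_xy)
  \<comment> \<open>The determinant in the weight cancels the denominator of Cramer's rule; for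
    singular designs both sides vanish.\<close>
  have component: "(g (fst (unzip \<omega>)) *\<^sub>R w (unzip \<omega>)) $ a
      = det (\<chi> r c. \<Sum>i\<in>UNIV. fst (\<omega> i) $ r * v a (\<omega> i) c) / (C * det (Sigma DX))" for \<omega> a
  proof -
    let ?xs = "\<lambda>i. fst (\<omega> i)" and ?ys = "\<lambda>i. snd (\<omega> i)"
    have "(\<chi> r c. \<Sum>i\<in>UNIV. fst (\<omega> i) $ r * v a (\<omega> i) c) =
        (\<chi> i j. if j = a then (transpose (design ?xs) *v vec_lambda ?ys) $ i
           else (transpose (design ?xs) ** design ?xs) $ i $ j)"
      by (simp add: vec_eq_iff v_def gram_design_nth transpose_design_mult_nth)
    then show ?thesis
      by (simp add: cramer_gram_pinv g_def w_def unzip_def wstar_S_def)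
  qed
  have int_component: "integrable ?P (\<lambda>\<omega>. (g (fst (unzip \<omega>)) *\<^sub>R w (unzip \<omega>)) $ a)" for a
    unfolding component by (intro integrable_divide J.expectation_det_sum_iid(1) uv assms)
  then have int: "integrable ?P (\<lambda>\<omega>. g (fst (unzip \<omega>)) *\<^sub>R w (unzip \<omega>))"
    by (rule integrable_cart_componentwise)
  \<comment> \<open>\<open>matrix_inv\<close> is a choice among inverses; invertibility makes the
    choice meaningful.\<close>
  have "Sigma DX ** matrix_inv (Sigma DX) = mat 1"
    using someI_ex[OF assms(6)[unfolded invertible_def]] by (simp add: matrix_inv_def)
  then have "Sigma DX *v wstar_D DX K = ?b"
    unfolding wstar_D_def by (simp add: matrix_vector_mul_assoc)
  then have cramer_D: "det (\<chi> r c. if c = a then ?b $ r else Sigma DX $ r $ c) = wstar_D DX K $ a * det (Sigma DX)" for a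
    using cramer_lemma[of a "Sigma DX" "wstar_D DX K"] by (simp cong: if_cong)
  \<comment> \<open>Column \<open>a\<close> holds the cross moments and the others are those of
    \<open>Sigma DX\<close>: the population version of the same Cramer numerator.\<close>
  have moments: "(\<chi> r c. \<integral>z. fst z $ r * v a z c \<partial>joint DX K) = (\<chi> r c. if c = a then ?b $ r else Sigma DX $ r $ c)" for a
    by (simp add: vec_eq_iff v_def Sigma_nth cross_moment_nth)
  have "(\<integral>\<omega>. g (fst (unzip \<omega>)) *\<^sub>R w (unzip \<omega>) \<partial>?P) = wstar_D DX K"
  proof (subst vec_eq_iff, rule allI)
    fix a
    have "(\<integral>\<omega>. g (fst (unzip \<omega>)) *\<^sub>R w (unzip \<omega>) \<partial>?P) $ a
        = (\<integral>\<omega>. det (\<chi> r c. \<Sum>i\<in>UNIV. fst (\<omega> i) $ r * v a (\<omega> i) c) \<partial>?P) / (C * det (Sigma DX))"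
      by (simp only: integral_cart_nth[OF int] component integral_divide_zero)
    also have "\<dots> = C * det (\<chi> r c. \<integral>z. fst z $ r * v a z c \<partial>joint DX K) / (C * det (Sigma DX))"
      unfolding C_def by (subst J.expectation_det_sum_iid(2)) (simp_all add: uv assms)
    also have "\<dots> = wstar_D DX K $ a"
      using C det_Sigma by (simp add: moments cramer_D)
    finally show "(\<integral>\<omega>. g (fst (unzip \<omega>)) *\<^sub>R w (unzip \<omega>) \<partial>?P) $ a = wstar_D DX K $ a" .
  qed
  \<comment> \<open>The integral is unfolded through the density and then through the image under
    \<open>unzip\<close>, ending at the i.i.d. pairs.\<close>
  moreover have "integral\<^sup>L (VS_D DX K) w = (\<integral>\<omega>. g (fst (unzip \<omega>)) *\<^sub>R w (unzip \<omega>) \<partial>?P)"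
    unfolding VS by (subst integral_density) (simp_all add: g_nonneg integral_distr)
  moreover have "integrable (VS_D DX K) w"
    unfolding VS by (subst integrable_density) (simp_all add: g_nonneg integrable_distr_eq int)
  ultimately show ?thesis
    by (simp add: w_def)
qed

end
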